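(* Let $a_1\in\mathbb{R}$, $b\in\mathbb{R}\setminus\{0\}$, and consider the three-stage stochastic Runge-Kutta (SRK) scheme ($s=3$) with coefficients $$A=\begin{pmatrix} a_1 & 0 & 0 \\ a_4 & a_2 & 0 \\ 1-a_3 & 0 & a_3 \end{pmatrix},\quad B^{(1)}=\begin{pmatrix} 0 & 0 & 0 \\ 0 & 0 & 0 \\ 1 & 0 & 0 \end{pmatrix},\quad B^{(2)}=\begin{pmatrix} 0 & 0 & 0 \\ 0 & 0 & 0 \\ -\frac1b & \frac1b & 0 \end{pmatrix},\quad B^{(3)}=\begin{pmatrix} 0 & 0 & 0 \\ b & 0 & 0 \\ 0 & 0 & 0 \end{pmatrix}$$ in the case $a_2=a_1$, $a_3=1$ and $a_4=0$. This (strong order 1.0) scheme is $A$-stable for the linear test equation $\mathrm{d}X_t=\lambda X_t\,\mathrm{d}t+\mu X_t\,\mathrm{d}W_t$ ($\lambda,\mu\in\mathbb{C}$), i.e. $\mathcal{D}_{SDE}\subseteq\mathcal{D}_{SRK}$, if and only if $a_1\ge\frac14$ (with $b\in\mathbb{R}\setminus\{0\}$ arbitrary).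
   Context: A stiffly accurate $s$-stage SRK method with real $s\times s$ coefficient matrices $A,B^{(1)},B^{(2)},B^{(3)}$, applied with constant step size $h>0$ to the scalar test equation $\mathrm{d}X_t=\lambda X_t\,\mathrm{d}t+\mu X_t\,\mathrm{d}W_t$ ($W$ a real Wiener process, Itô sense, $\lambda,\mu\in\mathbb{C}$), computes stages $H=(H_1,\dots,H_s)^T$ from $$H=e\,y_n+\lambda hAH+\mu\Big(I_{(1),n}B^{(1)}+\tfrac{I_{(1,1),n}}{\sqrt h}B^{(2)}+\sqrt h\,B^{(3)}\Big)H,\qquad y_{n+1}=H_s,$$ where $e=(1,\dots,1)^T\in\mathbb{R}^s$, $I_{(1),n}=\sqrt h\,\xi_n$ with $\xi_n\sim N(0,1)$ independent, and $I_{(1,1),n}=\frac12(I_{(1),n}^2-h)$. With $\hat h=\lambda h$ and $k=\mu\sqrt h$ this gives $y_{n+1}=R_n(\hat h,k)\,y_n$, with stability function $$R_n(\hat h,k)=\varepsilon_s^T\Big(I_s-\hat hA-k\big(\xi_nB^{(1)}+\tfrac12(\xi_n^2-1)B^{(2)}+B^{(3)}\big)\Big)^{-1}e,\qquad \varepsilon_s=(0,\dots,0,1)^T\in\mathbb{R}^s,$$ $I_s$ the identity matrix, defined wherever the inverse exists. Put $\hat R(\hat h,k)=\mathrm{E}(|R_n(\hat h,k)|^2)$. Domains of mean-square stability: $\mathcal{D}_{SDE}=\{(\lambda,\mu)\in\mathbb{C}^2: 2\Re(\lambda)+|\mu|^2<0\}$ and $\mathcal{D}_{SRK}=\{(\hat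 h,k)\in\mathbb{C}^2:\hat R(\hat h,k)<1\}$. The method is called $A$-stable if $\mathcal{D}_{SDE}\subseteq\mathcal{D}_{SRK}$, i.e. if $\hat R(\hat h,k)<1$ for all $(\hat h,k)\in\mathbb{C}^2$ with $2\Re(\hat h)+|k|^2<0$. *)

theory Defs
  imports "HOL-Probability.Probability"
begin

abbreviation std_normal :: "real measure"
  where "std_normal \<equiv> density lborel (\<lambda>x. ennreal (std_normal_density x))"

definition stage_matrix ::
  "real^'s^'s \<Rightarrow> real^'s^'s \<Rightarrow> real^'s^'s \<Rightarrow> real^'s^'s \<Rightarrow> complex \<Rightarrow> complex \<Rightarrow> real \<Rightarrow> complex^'s^'s"
  where "stage_matrix A B1 B2 B3 h k \<xi> =
    mat 1 - map_matrix (\<lambda>a. h * complex_of_real a) A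
          - map_matrix (\<lambda>c. k * complex_of_real c) (\<xi> *\<^sub>R B1 + (1/2 * (\<xi>^2 - 1)) *\<^sub>R B2 + B3)"

text \<open>The stages are indexed by an arbitrary finite type; \<open>l\<close> is the index of the last stage.
  The value is meaningful only where the stage matrix is invertible.\<close>

definition stability_fun ::
  "real^'s^'s \<Rightarrow> real^'s^'s \<Rightarrow> real^'s^'s \<Rightarrow> real^'s^'s \<Rightarrow> 's \<Rightarrow> complex \<Rightarrow> complex \<Rightarrow> real \<Rightarrow> complex"
  where "stability_fun A B1 B2 B3 l h k \<xi> =
    (matrix_inv (stage_matrix A B1 B2 B3 h k \<xi>) *v (\<chi> i. 1)) $ l"

definition ms_stability_fun ::
  "real^'s^'s \<Rightarrow> real^'s^'s \<Rightarrow> real^'s^'s \<Rightarrow> real^'s^'s \<Rightarrow> 's \<Rightarrow> complex \<Rightarrow> complex \<Rightarrow> real"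
  where "ms_stability_fun A B1 B2 B3 l h k =
    (LINT \<xi>|std_normal. (cmod (stability_fun A B1 B2 B3 l h k \<xi>))^2)"

definition D_SDE :: "(complex \<times> complex) set"
  where "D_SDE = {(lam, mu). 2 * Re lam + (cmod mu)^2 < 0}"

text \<open>Both \<^const>\<open>matrix_inv\<close> and the Bochner integral are total, so a pair belongs to the domain
  of the method only if the stability function is almost surely defined and its second moment
  is finite.\<close>

definition D_SRK ::
  "real^'s^'s \<Rightarrow> real^'s^'s \<Rightarrow> real^'s^'s \<Rightarrow> real^'s^'s \<Rightarrow> 's \<Rightarrow> (complex \<times> complex) set"
  where "D_SRK A B1 B2 B3 l = {(h, k).
    (AE \<xi> in std_normal. invertible (stage_matrix A B1 B2 B3 h k \<xi>)) \<and>
    integrable std_normal (\<lambda>\<xi>. (cmod (stability_fun A B1 B2 B3 l h k \<xi>))^2) \<and>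
    ms_stability_fun A B1 B2 B3 l h k < 1}"

definition A_stable ::
  "real^'s^'s \<Rightarrow> real^'s^'s \<Rightarrow> real^'s^'s \<Rightarrow> real^'s^'s \<Rightarrow> 's \<Rightarrow> bool"
  where "A_stable A B1 B2 B3 l \<longleftrightarrow> D_SDE \<subseteq> D_SRK A B1 B2 B3 l"

definition scheme_A :: "real \<Rightarrow> real \<Rightarrow> real \<Rightarrow> real \<Rightarrow> real^3^3"
  where "scheme_A a1 a2 a3 a4 =
    vector [vector [a1, 0, 0], vector [a4, a2, 0], vector [1 - a3, 0, a3]]"

definition scheme_B1 :: "real^3^3"
  where "scheme_B1 = vector [vector [0, 0, 0], vector [0, 0, 0], vector [1, 0, 0]]"

definition scheme_B2 :: "real \<Rightarrow> real^3^3"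
  where "scheme_B2 b = vector [vector [0, 0, 0], vector [0, 0, 0], vector [- (1 / b), 1 / b, 0]]"

definition scheme_B3 :: "real \<Rightarrow> real^3^3"
  where "scheme_B3 b = vector [vector [0, 0, 0], vector [b, 0, 0], vector [0, 0, 0]]"

end

theory Submission
  imports Defs
begin

text \<open>With \<open>u = k / (1 - h a\<^sub>1)\<close>, solving for the stages gives
  \<open>(1 - h) R = 1 + u \<xi> + u\<^sup>2 (\<xi>\<^sup>2 - 1) / 2\<close>, an expansion in Hermite polynomials.  By their
  orthogonality the mean-square stability function is
  \<open>(1 + |u|\<^sup>2 + |u|\<^sup>4 / 2) / |1 - h|\<^sup>2\<close>.  For \<open>p = - 2 Re h\<close> the condition \<open>a\<^sub>1 \<ge> 1/4\<close> is what the
  second order in \<open>p\<close> requires along real \<open>h\<close> as \<open>|k|\<^sup>2\<close> tends to \<open>p\<close> and \<open>p\<close> tends to \<open>0\<close>; conversely it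
  yields \<open>|1 - h a\<^sub>1|\<^sup>2 \<ge> 1 + p / 4\<close>, which suffices for all \<open>p\<close>.\<close>

lemma std_normal_hermite_square:
  fixes \<alpha> \<beta> \<gamma> :: real
  shows "has_bochner_integral std_normal (\<lambda>x. (\<alpha> + \<beta> * x + \<gamma> * ((x\<^sup>2 - 1) / 2))\<^sup>2) (\<alpha>\<^sup>2 + \<beta>\<^sup>2 + \<gamma>\<^sup>2 / 2)"
proof -
  \<comment> \<open>\<open>c0\<close> to \<open>c4\<close> are the coefficients of the integrand as
    a polynomial in \<open>x\<close>; they are paired with the Gaussian moments 1, 0, 1, 0,
    3.\<close>
  define c0 where "c0 = (\<alpha> - \<gamma> / 2)\<^sup>2"
  define c1 where "c1 = 2 * (\<alpha> - \<gamma> / 2) * \<beta>"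
  define c2 where "c2 = \<beta>\<^sup>2 + (\<alpha> - \<gamma> / 2) * \<gamma>"
  define c3 where "c3 = \<beta> * \<gamma>"
  define c4 where "c4 = \<gamma>\<^sup>2 / 4"
  have even: "has_bochner_integral lborel (\<lambda>x. std_normal_density x * x ^ (2 * n)) (fact (2 * n) / (2 ^ n * fact n))" for n
    by (rule std_normal_moment_even)
  have odd: "has_bochner_integral lborel (\<lambda>x. std_normal_density x * x ^ (2 * n + 1)) 0" for n
    by (rule std_normal_moment_odd)
  have "has_bochner_integral lborel
      (\<lambda>x. c0 * (std_normal_density x * x ^ (2 * 0)) + c1 * (std_normal_density x * x ^ (2 * 0 + 1))
         + c2 * (std_normal_density x * x ^ (2 * 1)) + c3 * (std_normal_density x * x ^ (2 * 1 + 1))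
         + c4 * (std_normal_density x * x ^ (2 * 2)))
      (c0 * (fact (2 * 0) / (2 ^ 0 * fact 0)) + c1 * 0 + c2 * (fact (2 * 1) / (2 ^ 1 * fact 1)) + c3 * 0
         + c4 * (fact (2 * 2) / (2 ^ 2 * fact 2)))"
    by (intro has_bochner_integral_add has_bochner_integral_mult_right even odd)
  also have "(c0 * (fact (2 * 0) / (2 ^ 0 * fact 0)) + c1 * 0 + c2 * (fact (2 * 1) / (2 ^ 1 * fact 1)) + c3 * 0
         + c4 * (fact (2 * 2) / (2 ^ 2 * fact 2))) = \<alpha>\<^sup>2 + \<beta>\<^sup>2 + \<gamma>\<^sup>2 / 2"
    by (simp add: c0_def c2_def c4_def fact_numeral power2_eq_square field_simps)
  also have "(\<lambda>x. c0 * (std_normal_density x * x ^ (2 * 0)) + c1 * (std_normal_density x * x ^ (2 * 0 + 1))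
         + c2 * (std_normal_density x * x ^ (2 * 1)) + c3 * (std_normal_density x * x ^ (2 * 1 + 1))
         + c4 * (std_normal_density x * x ^ (2 * 2)))
      = (\<lambda>x. std_normal_density x *\<^sub>R (\<alpha> + \<beta> * x + \<gamma> * ((x\<^sup>2 - 1) / 2))\<^sup>2)"
    by (rule ext) (simp add: c0_def c1_def c2_def c3_def c4_def power2_eq_square power3_eq_cube
        power4_eq_xxxx field_simps)
  finally show ?thesis
    by (intro has_bochner_integral_density) auto
qed

text \<open>Since \<open>x\<close> is real, the real and imaginary parts are real Hermite
  combinations; their second moments add up to squared moduli of the coefficients.\<close>

lemma std_normal_complex_hermite_square:
  fixes u :: complex
  shows "has_bochner_integral std_normal
    (\<lambda>x. (cmod (1 + u * of_real x + u\<^sup>2 * of_real ((x\<^sup>2 - 1) / 2)))\<^sup>2)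
    (1 + (cmod u)\<^sup>2 + (cmod u) ^ 4 / 2)"
proof -
  have "has_bochner_integral std_normal
    (\<lambda>x. (1 + Re u * x + Re (u\<^sup>2) * ((x\<^sup>2 - 1) / 2))\<^sup>2 + (0 + Im u * x + Im (u\<^sup>2) * ((x\<^sup>2 - 1) / 2))\<^sup>2)
    ((1\<^sup>2 + (Re u)\<^sup>2 + (Re (u\<^sup>2))\<^sup>2 / 2) + (0\<^sup>2 + (Im u)\<^sup>2 + (Im (u\<^sup>2))\<^sup>2 / 2))"
    by (intro has_bochner_integral_add std_normal_hermite_square)
  also have "(1\<^sup>2 + (Re u)\<^sup>2 + (Re (u\<^sup>2))\<^sup>2 / 2) + (0\<^sup>2 + (Im u)\<^sup>2 + (Im (u\<^sup>2))\<^sup>2 / 2)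
      = 1 + (cmod u)\<^sup>2 + (cmod (u\<^sup>2))\<^sup>2 / 2"
    unfolding cmod_power2 by (simp add: field_simps)
  also have "(cmod (u\<^sup>2))\<^sup>2 = cmod u ^ 4"
    by (simp add: norm_power flip: power_mult)
  finally show ?thesis
    by (simp add: cmod_power2[of "_ + _"])
qed

lemma stage_matrix_scheme:
  assumes "b \<noteq> 0"
  shows "stage_matrix (scheme_A a a 1 0) scheme_B1 (scheme_B2 b) (scheme_B3 b) h k x =
    vector [vector [1 - h * of_real a, 0, 0],
            vector [- k * of_real b, 1 - h * of_real a, 0],
            vector [- k * of_real (x - (x\<^sup>2 - 1) / 2 / b), - k * of_real ((x\<^sup>2 - 1) / 2 / b), 1 - h]]"
  using assms
  by (simp add: stage_matrix_def scheme_A_def scheme_B1_def scheme_B2_def scheme_B3_def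
      vec_eq_iff forall_3 mat_def map_matrix_def field_simps)

text \<open>The matrix is lower triangular with a diagonal free of \<open>x\<close>, so the almost
  sure condition in \<open>D_SRK\<close> holds for every \<open>x\<close> or for none.\<close>

lemma invertible_stage_matrix_scheme:
  assumes "b \<noteq> 0"
  shows "invertible (stage_matrix (scheme_A a a 1 0) scheme_B1 (scheme_B2 b) (scheme_B3 b) h k x)
    \<longleftrightarrow> 1 - h * of_real a \<noteq> 0 \<and> h \<noteq> 1"
  by (simp add: stage_matrix_scheme[OF assms] invertible_det_nz det_3)

text \<open>Reduces evaluating the stability function to exhibiting one solution of the stage
  equations.\<close>

lemma matrix_inv_mult_eqI:
  fixes M :: "'a::field^'n^'n"
  assumes "invertible M" and "M *v x = y"
  shows "matrix_inv M *v y = x"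
proof -
  have "M ** matrix_inv M = mat 1 \<and> matrix_inv M ** M = mat 1"
    using assms(1) unfolding invertible_def matrix_inv_def by (rule someI_ex)
  then show ?thesis
    using assms(2) by (metis matrix_vector_mul_assoc matrix_vector_mul_lid)
qed

lemma stability_fun_scheme:
  fixes h k :: complex
  assumes "b \<noteq> 0" and "1 - h * of_real a \<noteq> 0" and "h \<noteq> 1"
  defines "u \<equiv> k / (1 - h * of_real a)"
  shows "stability_fun (scheme_A a a 1 0) scheme_B1 (scheme_B2 b) (scheme_B3 b) 3 h k x =
    (1 + u * of_real x + u\<^sup>2 * of_real ((x\<^sup>2 - 1) / 2)) / (1 - h)"
proof -
  define d where "d = 1 - h * of_real a"
  define q :: complex where "q = of_real ((x\<^sup>2 - 1) / 2)"
  define r where "r = (1 + u * of_real x + u\<^sup>2 * q) / (1 - h)"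
  \<comment> \<open>Forward substitution. The first two stages differ by \<open>u * b / d\<close>,
    so the factor \<open>1 / b\<close> in \<open>scheme_B2\<close> cancels \<open>b\<close> and
    leaves the term \<open>u\<^sup>2 * q\<close> in the last stage.\<close>
  define y :: "complex^3" where "y = vector [1 / d, (1 + u * of_real b) / d, r]"
  let ?M = "stage_matrix (scheme_A a a 1 0) scheme_B1 (scheme_B2 b) (scheme_B3 b) h k x"
  have d: "d \<noteq> 0" and u: "u = k / d"
    using assms by (auto simp: d_def)
  have r: "(1 - h) * r = 1 + u * of_real x + u\<^sup>2 * q"
    using assms by (simp add: r_def)
  have M: "?M = vector [vector [d, 0, 0], vector [- k * of_real b, d, 0],
      vector [- k * (of_real x - q / of_real b), - k * (q / of_real b), 1 - h]]"
    by (simp add: stage_matrix_scheme[OF assms(1)] d_def q_def)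
  have row3: "- k * (of_real x - q / of_real b) * (1 / d) + - k * (q / of_real b) * ((1 + u * of_real b) / d)
      + (1 - h) * r = 1"
    unfolding r u using d assms(1) by (simp add: field_simps power2_eq_square)
  have row2: "- k * of_real b * (1 / d) + d * ((1 + u * of_real b) / d) = 1"
    unfolding u using d by (simp add: field_simps)
  have "?M *v y = (\<chi> i. 1)"
    unfolding M using d row2 row3
    by (simp add: vec_eq_iff forall_3 matrix_vector_mult_def sum_3 y_def)
  then have "matrix_inv ?M *v (\<chi> i. 1) = y"
    using assms by (intro matrix_inv_mult_eqI) (simp_all add: invertible_stage_matrix_scheme)
  then show ?thesis
    by (simp add: stability_fun_def y_def r_def q_def)
qed

text \<open>Eliminates \<open>b\<close> and the randomness: both directions of the theorem now
  concern one real inequality in moduli.\<close>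

lemma D_SRK_scheme_iff:
  fixes h k :: complex
  assumes "b \<noteq> 0" and "1 - h * of_real a \<noteq> 0" and "h \<noteq> 1"
  defines "t \<equiv> (cmod k)\<^sup>2 / (cmod (1 - h * of_real a))\<^sup>2"
  shows "(h, k) \<in> D_SRK (scheme_A a a 1 0) scheme_B1 (scheme_B2 b) (scheme_B3 b) 3
    \<longleftrightarrow> 1 + t + t\<^sup>2 / 2 < (cmod (1 - h))\<^sup>2"
proof -
  define u where "u = k / (1 - h * of_real a)"
  have t: "(cmod u)\<^sup>2 = t" "cmod u ^ 4 = t\<^sup>2"
    by (simp_all add: u_def t_def norm_divide power_divide flip: power_mult)
  have "has_bochner_integral std_normal
    (\<lambda>x. (cmod (1 + u * of_real x + u\<^sup>2 * of_real ((x\<^sup>2 - 1) / 2)))\<^sup>2 / (cmod (1 - h))\<^sup>2)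
    ((1 + t + t\<^sup>2 / 2) / (cmod (1 - h))\<^sup>2)"
    using has_bochner_integral_divide_zero[OF std_normal_complex_hermite_square[of u], of "(cmod (1 - h))\<^sup>2"]
    by (simp add: t)
  then have "has_bochner_integral std_normal
    (\<lambda>x. (cmod (stability_fun (scheme_A a a 1 0) scheme_B1 (scheme_B2 b) (scheme_B3 b) 3 h k x))\<^sup>2)
    ((1 + t + t\<^sup>2 / 2) / (cmod (1 - h))\<^sup>2)"
    unfolding stability_fun_scheme[OF assms(1-3)] norm_divide power_divide u_def .
  then show ?thesis
    using assms(1-3)
    by (simp add: D_SRK_def ms_stability_fun_def has_bochner_integral_iff
        invertible_stage_matrix_scheme divide_less_eq)
qed

lemma cmod_one_minus_scaled:
  "(cmod (1 - h * of_real a))\<^sup>2 = 1 - 2 * a * Re h + a\<^sup>2 * (cmod h)\<^sup>2"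
  unfolding cmod_power2 by (simp add: power2_eq_square algebra_simps)

text \<open>Here \<open>K\<close>, \<open>m\<close>, \<open>D\<close> stand for the squared moduli
  of \<open>k\<close>, \<open>h\<close> and \<open>1 - h * a\<close>. The left side increases with
  \<open>K\<close>, so a non-strict bound at \<open>K = p\<close> suffices.\<close>

lemma mean_square_contraction:
  fixes p m K D :: real
  assumes "0 \<le> K" "K < p" "p\<^sup>2 / 4 \<le> m" "1 + p / 4 \<le> D"
  shows "K / D + (K / D)\<^sup>2 / 2 < p + m"
proof -
  have p: "0 < p" and D: "1 \<le> D" "0 < D" using assms by auto
  \<comment> \<open>Clearing denominators at \<open>K = p\<close> and cancelling \<open>p\<close>
    leaves \<open>2 * p \<le> p * D\<^sup>2 + 4 * D * (D - 1)\<close>; each summand on the right is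
    at least \<open>p\<close>.\<close>
  have "p * D\<^sup>2 \<ge> p * 1" "p * D \<ge> p * 1"
    using p D by (intro mult_left_mono; simp)+
  moreover have "D * (4 * (D - 1)) \<ge> D * p"
    using assms D by (intro mult_left_mono) auto
  ultimately have "2 * p \<le> p * D\<^sup>2 + 4 * D * (D - 1)" by (simp add: algebra_simps)
  then have "p * (2 * p) \<le> p * (p * D\<^sup>2 + 4 * D * (D - 1))"
    using p by (intro mult_left_mono) auto
  then have "p / D + (p / D)\<^sup>2 / 2 \<le> p + p\<^sup>2 / 4"
    using D by (simp add: field_simps power2_eq_square)
  moreover have "K / D < p / D" using assms D by (simp add: divide_strict_right_mono)
  moreover have "(K / D)\<^sup>2 \<le> (p / D)\<^sup>2" using assms D by (intro power_mono divide_right_mono) auto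
  ultimately show ?thesis using assms(3) by argo
qed

lemma A_stable_scheme_if:
  assumes "b \<noteq> 0" and a: "1 / 4 \<le> a"
  shows "A_stable (scheme_A a a 1 0) scheme_B1 (scheme_B2 b) (scheme_B3 b) 3"
proof -
  have "(h, k) \<in> D_SRK (scheme_A a a 1 0) scheme_B1 (scheme_B2 b) (scheme_B3 b) 3"
    if hk: "2 * Re h + (cmod k)\<^sup>2 < 0" for h k
  proof -
    define p where "p = - 2 * Re h"
    define D where "D = (cmod (1 - h * of_real a))\<^sup>2"
    have K: "(cmod k)\<^sup>2 < p" using hk by (simp add: p_def)
    then have p: "0 < p" by (meson le_less_trans zero_le_power2)
    have m: "p\<^sup>2 / 4 \<le> (cmod h)\<^sup>2" by (simp add: p_def cmod_power2 power_mult_distrib)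
    have "1 / 4 * p \<le> a * p" using a p by (intro mult_right_mono) auto
    then have D: "1 + p / 4 \<le> D"
      by (simp add: D_def cmod_one_minus_scaled p_def add_increasing2)
    \<comment> \<open>\<open>D > 1\<close> keeps \<open>h\<close> away from the pole at
      \<open>1 / a\<close>, and \<open>Re h < 0\<close> keeps it away from 1.\<close>
    then have "1 - h * of_real a \<noteq> 0" using p by (auto simp: D_def)
    moreover have "h \<noteq> 1" using p by (auto simp: p_def)
    moreover have "(cmod (1 - h))\<^sup>2 = 1 + p + (cmod h)\<^sup>2"
      using cmod_one_minus_scaled[of h 1] by (simp add: p_def)
    ultimately show ?thesis
      using mean_square_contraction[OF _ K m D] assms(1)
      by (subst D_SRK_scheme_iff) (auto simp: D_def)
  qed
  then show ?thesis
    by (auto simp: A_stable_def D_SDE_def)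
qed

lemma A_stable_scheme_only_if:
  assumes "b \<noteq> 0"
    and stable: "A_stable (scheme_A a a 1 0) scheme_B1 (scheme_B2 b) (scheme_B3 b) 3"
  shows "1 / 4 \<le> a"
proof -
  define D where "D p = (1 + a * p / 2)\<^sup>2" for p :: real
  have stab: "K / D p + (K / D p)\<^sup>2 / 2 < p + p\<^sup>2 / 4"
    if "0 \<le> K" "K < p" "1 + a * p / 2 \<noteq> 0" for K p
  proof -
    \<comment> \<open>Real test points, for which \<open>D_SDE\<close> reads \<open>K < p\<close>.
      No sign of \<open>a\<close> is assumed, so the pole \<open>1 + a * p / 2 = 0\<close> has to be
      excluded.\<close>
    define h where "h = complex_of_real (- p / 2)"
    define k where "k = complex_of_real (sqrt K)"
    have ha: "1 - h * of_real a = complex_of_real (1 + a * p / 2)"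
      by (simp add: h_def)
    have h1: "1 - h = complex_of_real (1 + p / 2)"
      by (simp add: h_def)
    have "h \<noteq> 1"
      using h1 that by (auto simp del: of_real_add)
    moreover have "1 - h * of_real a \<noteq> 0"
      unfolding ha using that by (simp only: of_real_eq_0_iff) simp
    moreover have "(cmod k)\<^sup>2 = K" using that by (simp add: k_def)
    moreover from this have "(h, k) \<in> D_SRK (scheme_A a a 1 0) scheme_B1 (scheme_B2 b) (scheme_B3 b) 3"
      using stable that by (auto simp: A_stable_def D_SDE_def h_def)
    moreover have "(cmod (1 - h * of_real a))\<^sup>2 = D p"
      unfolding ha norm_of_real by (simp add: D_def)
    moreover have "(cmod (1 - h))\<^sup>2 = 1 + p + p\<^sup>2 / 4"
      unfolding h1 norm_of_real by (simp add: power2_eq_square field_simps)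
    ultimately show ?thesis
      using D_SRK_scheme_iff[OF assms(1), of h a k] by simp
  qed
  \<comment> \<open>\<open>p * f p\<close> is the inequality at \<open>K = p\<close> with
    denominators cleared and one factor \<open>p\<close> cancelled; dividing by \<open>p\<close>
    once more gives \<open>f\<close>, with \<open>f 0 = 4 * a - 1\<close>.\<close>
  define f where "f p = 4 * D p * (a + a\<^sup>2 * p / 4) + (D p)\<^sup>2 - 2" for p
  have f_nonneg: "0 \<le> f p" if p: "0 < p" "1 + a * p / 2 \<noteq> 0" for p
  proof -
    have D: "D p > 0" using p by (simp add: D_def)
    \<comment> \<open>The point \<open>K = p\<close> lies outside \<open>D_SDE\<close>, so it is
      reached as a limit from the left, at the cost of strictness.\<close>
    have "((\<lambda>K. K / D p + (K / D p)\<^sup>2 / 2) \<longlongrightarrow> p / D p + (p / D p)\<^sup>2 / 2) (at_left p)"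
      using D by (intro tendsto_intros) auto
    moreover have "\<forall>\<^sub>F K in at_left p. K / D p + (K / D p)\<^sup>2 / 2 \<le> p + p\<^sup>2 / 4"
      using eventually_at_left_real[OF p(1)]
      by eventually_elim (use stab p in \<open>auto intro: less_imp_le\<close>)
    ultimately have "p / D p + (p / D p)\<^sup>2 / 2 \<le> p + p\<^sup>2 / 4"
      by (rule tendsto_upperbound) simp
    then have "p * (4 * D p + 2 * p) \<le> p * ((4 + p) * (D p)\<^sup>2)"
      using D by (simp add: field_simps power2_eq_square)
    then have "4 * D p + 2 * p \<le> (4 + p) * (D p)\<^sup>2"
      using p by (simp only: mult_le_cancel_left_pos)
    moreover have "(4 + p) * (D p)\<^sup>2 - (4 * D p + 2 * p) = 4 * D p * (D p - 1) + p * (D p)\<^sup>2 - 2 * p"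
      by (simp add: power2_eq_square algebra_simps)
    moreover have "D p - 1 = p * (a + a\<^sup>2 * p / 4)"
      by (simp add: D_def power2_eq_square field_simps)
    ultimately have "0 \<le> p * f p"
      by (simp add: f_def algebra_simps)
    then show ?thesis using p by (simp add: zero_le_mult_iff)
  qed
  \<comment> \<open>Even for negative \<open>a\<close>, small \<open>p\<close> avoid the pole, so
    \<open>f\<close> is nonnegative near 0 and its limit gives the bound on
    \<open>a\<close>.\<close>
  have "((\<lambda>p. 1 + a * p / 2) \<longlongrightarrow> 1 + a * 0 / 2) (at_right 0)"
    by (intro tendsto_intros) auto
  then have "\<forall>\<^sub>F p in at_right 0. 1 + a * p / 2 \<noteq> 0"
    by (rule tendsto_imp_eventually_ne) simp
  then have "\<forall>\<^sub>F p in at_right 0. 0 \<le> f p"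
    using eventually_at_right_less[of 0] by eventually_elim (rule f_nonneg)
  moreover have "(f \<longlongrightarrow> f 0) (at_right 0)"
    unfolding f_def D_def by (intro tendsto_intros) auto
  ultimately have "0 \<le> f 0"
    by (intro tendsto_lowerbound) auto
  then show ?thesis by (simp add: f_def D_def)
qed

theorem lemma5p6:
  fixes a1 a2 a3 a4 b :: real
  assumes "b \<noteq> 0" and "a2 = a1" and "a3 = 1" and "a4 = 0"
  shows "A_stable (scheme_A a1 a2 a3 a4) scheme_B1 (scheme_B2 b) (scheme_B3 b) 3 \<longleftrightarrow> a1 \<ge> 1/4"
  using assms A_stable_scheme_if[of b a1] A_stable_scheme_only_if[of b a1] by auto

end
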